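(* Let $\mathbf P=(P,\leq)$ be a poset, $a,b\in P$ with $a\leq b$, $x\in[a,b]$, and let $y$ be a complement of $x$. Assume that $(a,y,b)$ is a modular triple of $\mathbf P$ and that $e$ is the greatest element of $L\big(U(a,y),b\big)=LU\big(a,L(y,b)\big)$. Then the following are equivalent: (i) $e\in R(a,b,x)$; (ii) $L\Big(U\big(a,L(y,b)\big),x\Big)=LU\big(a,L(a,b,x)\big)$ and $L\big(U(x,a,y),b\big)=LU\Big(x,L\big(U(a,y),b\big)\Big)$.
   Context: In a poset $(P,\leq)$, for $A\subseteq P$ let $L(A)=\{p\in P\mid p\leq a\text{ for all }a\in A\}$ and $U(A)=\{p\in P\mid a\leq p\text{ for all }a\in A\}$. One writes $L(a)$ for $L(\{a\})$, $L(a,b,x)$ for $L(\{a,b,x\})$, $L(A,a)$ for $L(A\cup\{a\})$, $U(a,A)$ for $U(\{a\}\cup A)$, $LU(A)$ for $L(U(A))$, and similarly. An element $y$ is a complement of $x$ if $LU(x,y)=UL(x,y)=P$. For $a\leq b$ and $x\in[a,b]$, an element $z\in[a,b]$ is a relative complement of $x$ in $[a,b]$ if $U(x,z)=U(b)$ and $L(x,z)=L(a)$; $R(a,b,x)$ denotes the set of all such relative complements. A triple $(p,q,r)$ of elements of $P$ is a modular triple of $\mathbf P$ if $p\leq r$ and $L\big(U(p,q),r\big)=LU\big(p,L(q,r)\big)$. *)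

theory Defs
  imports Main
begin

text \<open>The poset is the type \<open>'a :: order\<close> with its order.\<close>

definition lower_cone :: "'a::order set \<Rightarrow> 'a set" where
  "lower_cone A = {p. \<forall>a\<in>A. p \<le> a}"

definition upper_cone :: "'a::order set \<Rightarrow> 'a set" where
  "upper_cone A = {p. \<forall>a\<in>A. a \<le> p}"

definition is_complement :: "'a::order \<Rightarrow> 'a \<Rightarrow> bool" where
  "is_complement y x \<longleftrightarrow>
     lower_cone (upper_cone {x, y}) = UNIV \<and> upper_cone (lower_cone {x, y}) = UNIV"

text \<open>Meaningful for \<open>a \<le> b\<close> and \<open>x \<in> {a..b}\<close>.\<close>

definition rel_complements :: "'a::order \<Rightarrow> 'a \<Rightarrow> 'a \<Rightarrow> 'a set" where
  "rel_complements a b x =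
     {z \<in> {a..b}. upper_cone {x, z} = upper_cone {b} \<and> lower_cone {x, z} = lower_cone {a}}"

definition modular_triple :: "'a::order \<Rightarrow> 'a \<Rightarrow> 'a \<Rightarrow> bool" where
  "modular_triple p q r \<longleftrightarrow>
     p \<le> r \<and>
     lower_cone (upper_cone {p, q} \<union> {r}) = lower_cone (upper_cone ({p} \<union> lower_cone {q, r}))"

definition is_greatest :: "'a::order \<Rightarrow> 'a set \<Rightarrow> bool" where
  "is_greatest e A \<longleftrightarrow> e \<in> A \<and> (\<forall>z\<in>A. z \<le> e)"

end

theory Submission
  imports Defs
begin

text \<open>
  Since \<open>e\<close> is greatest in a down-set, that down-set is \<open>L(e)\<close>; by the modular triple also
  \<open>U(a, L(y,b)) = ULU(a, L(y,b)) = U(e)\<close>. As \<open>a \<le> x \<le> b\<close>, the first equality in (ii) therefore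
  reads \<open>L(e,x) = L(a)\<close>. Every element of \<open>U(x,y)\<close> is a top element because \<open>LU(x,y) = P\<close>, so
  the second equality reads \<open>L(b) = LU(x,e)\<close>, that is \<open>U(x,e) = U(b)\<close>.
\<close>

text \<open>The two cones form an antitone Galois connection, so three alternating applications
  collapse to one.\<close>

lemma upper_lower_upper [simp]:
  "upper_cone (lower_cone (upper_cone A)) = upper_cone A"
  by (auto simp: upper_cone_def lower_cone_def)

lemma upper_cone_lower_cone_singleton [simp]:
  "upper_cone (lower_cone {c}) = upper_cone {c}"
  by (auto simp: upper_cone_def lower_cone_def intro: order_trans)

lemma lower_cone_upper_cone_singleton [simp]:
  "lower_cone (upper_cone {c}) = lower_cone {c}"
  by (auto simp: upper_cone_def lower_cone_def intro: order_trans)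

lemma upper_cone_Un: "upper_cone (A \<union> B) = upper_cone A \<inter> upper_cone B"
  by (auto simp: upper_cone_def)

lemma lower_cone_Un: "lower_cone (A \<union> B) = lower_cone A \<inter> lower_cone B"
  by (auto simp: lower_cone_def)

lemma is_greatest_lower_cone:
  assumes "is_greatest e (lower_cone A)"
  shows "lower_cone A = lower_cone {e}"
  using assms by (auto simp: is_greatest_def lower_cone_def intro: order_trans)

theorem theorem7:
  fixes a b x y e :: "'a::order"
  assumes "a \<le> b"
    and "x \<in> {a..b}"
    and "is_complement y x"
    and "modular_triple a y b"
    and "is_greatest e (lower_cone (upper_cone {a, y} \<union> {b}))"
  shows "e \<in> rel_complements a b x \<longleftrightarrow>
    lower_cone (upper_cone ({a} \<union> lower_cone {y, b}) \<union> {x})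
      = lower_cone (upper_cone ({a} \<union> lower_cone {a, b, x})) \<and>
    lower_cone (upper_cone {x, a, y} \<union> {b})
      = lower_cone (upper_cone ({x} \<union> lower_cone (upper_cone {a, y} \<union> {b})))"
proof -
  have Le: "lower_cone (upper_cone {a, y} \<union> {b}) = lower_cone {e}"
    using assms(5) by (rule is_greatest_lower_cone)
  have "lower_cone (upper_cone ({a} \<union> lower_cone {y, b})) = lower_cone {e}"
    using assms(4) Le by (simp add: modular_triple_def)
  then have Ue: "upper_cone ({a} \<union> lower_cone {y, b}) = upper_cone {e}"
    by (metis upper_lower_upper upper_cone_lower_cone_singleton)
  have e: "e \<in> {a..b}"
  proof -
    \<comment> \<open>\<open>e\<close> is the greatest element of this cone, so membership of
      \<open>a\<close> yields \<open>a \<le> e\<close>; membership of \<open>e\<close> itself yields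
      \<open>e \<le> b\<close>.\<close>
    have "a \<in> lower_cone (upper_cone {a, y} \<union> {b})"
      using assms(1) by (auto simp: lower_cone_def upper_cone_def)
    moreover have "e \<in> lower_cone (upper_cone {a, y} \<union> {b})"
      using assms(5) by (simp only: is_greatest_def)
    ultimately show ?thesis
      using assms(5) by (auto simp: is_greatest_def lower_cone_def)
  qed
  have first_left: "lower_cone (upper_cone ({a} \<union> lower_cone {y, b}) \<union> {x}) = lower_cone {x, e}"
    unfolding Ue lower_cone_Un lower_cone_upper_cone_singleton
    by (auto simp: lower_cone_def)
  have "lower_cone {a, b, x} = lower_cone {a}"
    using assms(1,2) by (auto simp: lower_cone_def)
  then have first_right:
    "lower_cone (upper_cone ({a} \<union> lower_cone {a, b, x})) = lower_cone {a}"
    by (simp only: upper_cone_Un upper_cone_lower_cone_singleton Int_absorb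
        lower_cone_upper_cone_singleton)
  \<comment> \<open>Any such \<open>u\<close> is also an upper bound of \<open>x\<close> and
    \<open>y\<close>. If no such \<open>u\<close> exists, the claim is vacuous and
    \<open>second_left\<close> still holds, since only the bound \<open>b\<close> remains.\<close>
  have top: "c \<le> u" if "u \<in> upper_cone {x, a, y}" for c u
  proof -
    have "c \<in> lower_cone (upper_cone {x, y})"
      using assms(3) by (simp add: is_complement_def)
    then show ?thesis
      using that by (auto simp: lower_cone_def upper_cone_def)
  qed
  then have second_left: "lower_cone (upper_cone {x, a, y} \<union> {b}) = lower_cone {b}"
    by (auto simp: lower_cone_def)
  have second_right: "upper_cone ({x} \<union> lower_cone {e}) = upper_cone {x, e}"
    unfolding upper_cone_Un upper_cone_lower_cone_singleton
    by (auto simp: upper_cone_def)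
  \<comment> \<open>Taking lower cones gives one direction. Taking upper cones gives the other, as
    UL(b) = U(b) and ULU(x,e) = U(x,e).\<close>
  have "upper_cone {x, e} = upper_cone {b} \<longleftrightarrow>
      lower_cone {b} = lower_cone (upper_cone {x, e})"
    by (metis upper_lower_upper upper_cone_lower_cone_singleton lower_cone_upper_cone_singleton)
  \<comment> \<open>Beyond the two cone equalities, \<open>rel_complements\<close> asks only for
    \<open>e \<in> {a..b}\<close>.\<close>
  then show ?thesis
    unfolding first_left first_right second_left Le second_right
    using e by (auto simp: rel_complements_def)
qed

end
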